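(* Let $\mathcal{C} = (\mathcal{H}, \mathcal{S}, m, n, \epsilon, \lambda, \rho)$ be a control improvisation instance, with set of improvisations $I$ and set of admissible improvisations $A$. The following are equivalent: (1) $\mathcal{C}$ is feasible. (2) The following inequalities all hold: (a) $1/\rho \le |I| \le 1/\lambda$; (b) $(1-\epsilon)/\rho \le |A|$; (c) $|I| - |A| \le \epsilon/\lambda$. (3) There is an improviser for $\mathcal{C}$.
   Context: A specification $\mathcal{X}$ is a finite representation of a language $L(\mathcal{X})$ over a finite alphabet $\Sigma$. A control improvisation (CI) instance is a tuple $\mathcal{C} = (\mathcal{H}, \mathcal{S}, m, n, \epsilon, \lambda, \rho)$ where $\mathcal{H}$ (hard specification) and $\mathcal{S}$ (soft specification) are specifications over a common finite alphabet $\Sigma$, $m,n \in \mathbb{N}$, and $\epsilon, \lambda, \rho \in [0,1] \cap \mathbb{Q}$. The set of improvisations is $I = \{ w \in L(\mathcal{H}) : m \le |w| \le n\}$ and the set of admissible improvisations is $A = I \cap L(\mathcal{S})$; both are finite. A probability distribution $D : \Sigma^* \to [0,1]$ is an improvising distribution for $\mathcal{C}$ if: (hard constraint) $\Pr[w \in I \mid w \leftarrow D] = 1$; (soft constraint) $\Pr[w \in A \mid w \leftarrow D] \ge 1-\epsilon$; (randomness) $\lambda \le D(w) \le \rho$ for all $w \in I$. $\mathcal{C}$ is feasible if an improvising distribution exists. An improviser for $\mathcal{C}$ is a probabilistic algorithm with finite expected running time, generating strings in $\Sigma^*$, whose output distribution (on empty input) is an improvising distribution for $\mathcal{C}$. Convention: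 if $\lambda = 0$, division by $\lambda$ yields $\infty$ (even for $\epsilon=0$), so the inequalities $|I| \le 1/\lambda$ and $|I|-|A| \le \epsilon/\lambda$ are trivially satisfied. If $\rho = 0$, then $1/\rho = \infty$, so (a) fails. *)

theory Defs
  imports "HOL-Probability.Probability"
begin

section \<open>Control improvisation instances\<close>

text \<open>
  A specification is a finite representation of a language. Specifications are elements of a
  countable type (equivalently, they can be encoded by finite strings), and what they represent is
  given by an arbitrary semantics \<open>L :: 'spec \<Rightarrow> 'a list set\<close>, passed as a parameter below.
\<close>

record ('spec, 'a) ci_instance =
  alphabet :: "'a set"
  hard_spec :: 'spec
  soft_spec :: 'spec
  min_length :: nat
  max_length :: nat
  eps :: rat
  lam :: rat
  rho :: rat

definition is_ci_instance ::
    "('spec::countable \<Rightarrow> 'a list set) \<Rightarrow> ('spec, 'a) ci_instance \<Rightarrow> bool" where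
  "is_ci_instance L C \<longleftrightarrow>
     finite (alphabet C) \<and>
     L (hard_spec C) \<subseteq> lists (alphabet C) \<and>
     L (soft_spec C) \<subseteq> lists (alphabet C) \<and>
     eps C \<in> {0..1} \<and> lam C \<in> {0..1} \<and> rho C \<in> {0..1}"

definition improvisations ::
    "('spec::countable \<Rightarrow> 'a list set) \<Rightarrow> ('spec, 'a) ci_instance \<Rightarrow> 'a list set" where
  "improvisations L C =
     {w \<in> L (hard_spec C). min_length C \<le> length w \<and> length w \<le> max_length C}"

definition admissible ::
    "('spec::countable \<Rightarrow> 'a list set) \<Rightarrow> ('spec, 'a) ci_instance \<Rightarrow> 'a list set" where
  "admissible L C = improvisations L C \<inter> L (soft_spec C)"

definition improvising_distribution ::
    "('spec::countable \<Rightarrow> 'a list set) \<Rightarrow> ('spec, 'a) ci_instance \<Rightarrow> 'a list pmf \<Rightarrow> bool" where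
  "improvising_distribution L C D \<longleftrightarrow>
     set_pmf D \<subseteq> lists (alphabet C) \<and>
     measure_pmf.prob D (improvisations L C) = 1 \<and>
     measure_pmf.prob D (admissible L C) \<ge> 1 - of_rat (eps C) \<and>
     (\<forall>w \<in> improvisations L C. of_rat (lam C) \<le> pmf D w \<and> pmf D w \<le> of_rat (rho C))"

definition feasible ::
    "('spec::countable \<Rightarrow> 'a list set) \<Rightarrow> ('spec, 'a) ci_instance \<Rightarrow> bool" where
  "feasible L C \<longleftrightarrow> (\<exists>D. improvising_distribution L C D)"

text \<open>
  Division by zero yields infinity, whatever the numerator. The library division on \<^typ>\<open>ereal\<close> is
  not suitable here, since it has \<open>0 / 0 = 0\<close>.
\<close>

definition ext_divide :: "rat \<Rightarrow> rat \<Rightarrow> ereal" where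
  "ext_divide x y = (if y = 0 then \<infinity> else ereal (of_rat (x / y)))"


section \<open>Probabilistic algorithms\<close>

text \<open>
  The model of a probabilistic algorithm is a probabilistic Turing machine: in each step a fair coin
  selects one of two transition functions. The machine has a two-way infinite work tape, initially
  blank (the input is empty), and a one-way write-only output tape, to which each step appends at
  most one symbol. States and tape symbols are taken from finite sets of natural numbers, with
  \<open>0\<close> as the blank symbol; this is no restriction up to renaming.
\<close>

datatype head_move = Move_Left | Move_Right | Stay

record 'a ptm =
  ptm_states :: "nat set"
  ptm_symbols :: "nat set"
  ptm_start :: nat
  ptm_halting :: "nat set"
  ptm_delta :: "bool \<Rightarrow> nat \<Rightarrow> nat \<Rightarrow> nat \<times> nat \<times> head_move \<times> 'a option"

definition is_ptm :: "'a set \<Rightarrow> 'a ptm \<Rightarrow> bool" where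
  "is_ptm \<Sigma> M \<longleftrightarrow>
     finite (ptm_states M) \<and> finite (ptm_symbols M) \<and>
     ptm_start M \<in> ptm_states M \<and> ptm_halting M \<subseteq> ptm_states M \<and> 0 \<in> ptm_symbols M \<and>
     (\<forall>b. \<forall>q \<in> ptm_states M - ptm_halting M. \<forall>g \<in> ptm_symbols M.
        ptm_delta M b q g \<in>
          ptm_states M \<times> ptm_symbols M \<times> UNIV \<times> insert None (Some ` \<Sigma>))"

record 'a config =
  state :: nat
  head_pos :: int
  tape :: "int \<Rightarrow> nat"
  written :: "'a list"

fun move_head :: "head_move \<Rightarrow> int \<Rightarrow> int" where
  "move_head Move_Left i = i - 1"
| "move_head Move_Right i = i + 1"
| "move_head Stay i = i"

definition initial_config :: "'a ptm \<Rightarrow> 'a config" where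
  "initial_config M = \<lparr>state = ptm_start M, head_pos = 0, tape = (\<lambda>_. 0), written = []\<rparr>"

definition halted :: "'a ptm \<Rightarrow> 'a config \<Rightarrow> bool" where
  "halted M c \<longleftrightarrow> state c \<in> ptm_halting M"

definition ptm_step :: "'a ptm \<Rightarrow> bool \<Rightarrow> 'a config \<Rightarrow> 'a config" where
  "ptm_step M b c =
     (if halted M c then c
      else case ptm_delta M b (state c) (tape c (head_pos c)) of (q, g, d, out) \<Rightarrow>
        \<lparr>state = q,
         head_pos = move_head d (head_pos c),
         tape = (tape c)(head_pos c := g),
         written = written c @ (case out of None \<Rightarrow> [] | Some a \<Rightarrow> [a])\<rparr>)"

text \<open>The \<open>t\<close>-th step uses the \<open>t\<close>-th coin toss of the sequence \<open>\<omega>\<close>.\<close>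

primrec ptm_run :: "'a ptm \<Rightarrow> bool stream \<Rightarrow> nat \<Rightarrow> 'a config" where
  "ptm_run M \<omega> 0 = initial_config M"
| "ptm_run M \<omega> (Suc t) = ptm_step M (\<omega> !! t) (ptm_run M \<omega> t)"

definition ptm_halts :: "'a ptm \<Rightarrow> bool stream \<Rightarrow> bool" where
  "ptm_halts M \<omega> \<longleftrightarrow> (\<exists>t. halted M (ptm_run M \<omega> t))"

definition halting_time :: "'a ptm \<Rightarrow> bool stream \<Rightarrow> nat" where
  "halting_time M \<omega> = (LEAST t. halted M (ptm_run M \<omega> t))"

definition running_time :: "'a ptm \<Rightarrow> bool stream \<Rightarrow> ennreal" where
  "running_time M \<omega> = (if ptm_halts M \<omega> then of_nat (halting_time M \<omega>) else \<infinity>)"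

definition ptm_output :: "'a ptm \<Rightarrow> bool stream \<Rightarrow> 'a list option" where
  "ptm_output M \<omega> =
     (if ptm_halts M \<omega> then Some (written (ptm_run M \<omega> (halting_time M \<omega>))) else None)"

definition coin_space :: "bool stream measure" where
  "coin_space = stream_space (measure_pmf (bernoulli_pmf (1/2)))"

definition expected_running_time :: "'a ptm \<Rightarrow> ennreal" where
  "expected_running_time M = (\<integral>\<^sup>+ \<omega>. running_time M \<omega> \<partial>coin_space)"

definition has_output_distribution :: "'a ptm \<Rightarrow> 'a list pmf \<Rightarrow> bool" where
  "has_output_distribution M D \<longleftrightarrow>
     (\<forall>w. measure coin_space {\<omega> \<in> space coin_space. ptm_output M \<omega> = Some w} = pmf D w)"

definition is_improviser ::
    "('spec::countable \<Rightarrow> 'a list set) \<Rightarrow> ('spec, 'a) ci_instance \<Rightarrow> 'a ptm \<Rightarrow> bool" where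
  "is_improviser L C M \<longleftrightarrow>
     is_ptm (alphabet C) M \<and>
     expected_running_time M < \<infinity> \<and>
     (\<exists>D. has_output_distribution M D \<and> improvising_distribution L C D)"

end

theory Submission
  imports Defs
begin

text \<open>
  (1) implies (2) by summing the pointwise bounds over \<open>I\<close>, \<open>A\<close> and \<open>I - A\<close>. Conversely, the inequalities
  leave room for a distribution that is uniform on \<open>A\<close> and uniform on \<open>I - A\<close> with rational weights,
  that is, for the uniform choice of an entry from a list of \<open>N\<close> words. A machine that ignores its tape
  samples it: its state is a pool, a list of \<open>N\<close> words. As long as the pool is not constant, each
  entry is duplicated and a coin toss selects the first or the second half of the resulting \<open>2 N\<close> entries;
  a constant pool is written letter by letter. The frequency of a word in the pool is a
  martingale, and from every pool some coin sequence of bounded length leads to a halt, so the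
  expected running time is finite and the output has the initial frequencies as its distribution.
\<close>

section \<open>Coin tosses and machine runs\<close>

lemma prob_space_coin_space: "prob_space coin_space"
  unfolding coin_space_def by (intro prob_space.prob_space_stream_space prob_space_measure_pmf)

lemma space_coin_space [simp]: "space coin_space = UNIV"
  by (simp add: coin_space_def space_stream_space)

lemma measurable_stake_coin_space: "stake t \<in> measurable coin_space (count_space UNIV)"
proof -
  have "sets coin_space = sets (stream_space (count_space (UNIV :: bool set)))"
    unfolding coin_space_def by (rule sets_stream_space_cong) simp
  then show ?thesis
    using measurable_stake measurable_cong_sets by blast
qed

lemma stake_event_sets [measurable]: "{\<omega>. P (stake t \<omega>)} \<in> sets coin_space"
  using measurable_sets[OF measurable_stake_coin_space, of "{bs. P bs}" t] by (simp add: vimage_def)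

text \<open>Conditioning on the first toss: a coin stream is a fair bit followed by an independent
  stream with the same law.\<close>

lemma prob_stake_Suc:
  "measure coin_space {\<omega>. P (stake (Suc t) \<omega>)} =
    (measure coin_space {\<omega>. P (False # stake t \<omega>)} +
     measure coin_space {\<omega>. P (True # stake t \<omega>)}) / 2"
proof -
  interpret coin: prob_space coin_space by (rule prob_space_coin_space)
  have "emeasure coin_space {\<omega>. P (stake (Suc t) \<omega>)} =
      (\<integral>\<^sup>+ b. emeasure coin_space {\<omega> \<in> space coin_space. b ## \<omega> \<in> {\<omega>. P (stake (Suc t) \<omega>)}}
        \<partial>measure_pmf (bernoulli_pmf (1/2)))"
    unfolding coin_space_def
    by (rule prob_space.emeasure_stream_space)
      (use stake_event_sets[of P "Suc t"] in \<open>auto simp: coin_space_def prob_space_measure_pmf\<close>)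
  also have "\<dots> = ennreal ((measure coin_space {\<omega>. P (False # stake t \<omega>)} +
     measure coin_space {\<omega>. P (True # stake t \<omega>)}) / 2)"
    by (simp add: coin.emeasure_eq_measure divide_ennreal_def[symmetric] divide_ennreal
        ennreal_plus[symmetric] add_divide_distrib add.commute flip: ennreal_numeral
        del: ennreal_plus)
  finally show ?thesis
    by (simp add: coin.emeasure_eq_measure)
qed

section \<open>Finite-time probabilities and the decay of survival\<close>

definition event_prob :: "'a ptm \<Rightarrow> ('a config \<Rightarrow> bool) \<Rightarrow> nat \<Rightarrow> 'a config \<Rightarrow> real" where
  "event_prob M P t c = measure coin_space {\<omega>. P (fold (ptm_step M) (stake t \<omega>) c)}"

lemma event_prob_0: "event_prob M P 0 c = of_bool (P c)"
  using prob_space.prob_space[OF prob_space_coin_space] by (simp add: event_prob_def)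

lemma event_prob_Suc:
  "event_prob M P (Suc t) c =
    (event_prob M P t (ptm_step M False c) + event_prob M P t (ptm_step M True c)) / 2"
  unfolding event_prob_def
  using prob_stake_Suc[of "\<lambda>bs. P (fold (ptm_step M) bs c)" t] by simp

lemma event_prob_nonneg: "0 \<le> event_prob M P t c"
  by (simp add: event_prob_def)

lemma event_prob_le_1: "event_prob M P t c \<le> 1"
  using prob_space.prob_le_1[OF prob_space_coin_space] by (simp add: event_prob_def)

lemma ptm_step_halted: "halted M c \<Longrightarrow> ptm_step M b c = c"
  by (simp add: ptm_step_def)

lemma fold_step_halted: "halted M c \<Longrightarrow> fold (ptm_step M) bs c = c"
  by (induction bs) (simp_all add: ptm_step_halted)

lemma event_prob_halted: "halted M c \<Longrightarrow> event_prob M P t c = of_bool (P c)"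
  by (induction t) (simp_all add: event_prob_0 event_prob_Suc ptm_step_halted)

text \<open>Connects \<open>ptm_run\<close>, which recurses on the last toss, with
  \<open>event_prob_Suc\<close>, which peels off the first one and therefore needs an arbitrary
  starting configuration.\<close>

lemma ptm_run_eq_fold: "ptm_run M \<omega> t = fold (ptm_step M) (stake t \<omega>) (initial_config M)"
  by (induction t) (simp_all add: stake_Suc del: stake.simps(2))

abbreviation survival :: "'a ptm \<Rightarrow> nat \<Rightarrow> 'a config \<Rightarrow> real" where
  "survival M \<equiv> event_prob M (\<lambda>c. \<not> halted M c)"

text \<open>The toss sequence \<open>bs\<close> by itself has probability
  \<open>1 / 2 ^ length bs\<close>, and it leads to a halt.\<close>

lemma survival_le_of_halting_path:
  assumes "halted M (fold (ptm_step M) bs c)"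
  shows "survival M (length bs) c \<le> 1 - 1 / 2 ^ length bs"
  using assms
proof (induction bs arbitrary: c)
  case Nil
  then show ?case by (simp add: event_prob_0)
next
  case (Cons b bs)
  have "survival M (length bs) (ptm_step M b c) \<le> 1 - 1 / 2 ^ length bs"
    using Cons by simp
  moreover have "survival M (length bs) (ptm_step M (\<not> b) c) \<le> 1"
    by (rule event_prob_le_1)
  ultimately have "survival M (Suc (length bs)) c \<le> ((1 - 1 / 2 ^ length bs) + 1) / 2"
    by (cases b) (simp_all add: event_prob_Suc)
  then show ?case
    by (simp add: field_simps)
qed

text \<open>Markov property: from whatever configuration of \<open>S\<close> is reached after
  \<open>t\<close> steps, surviving \<open>K\<close> more has probability at most
  \<open>q\<close>.\<close>

lemma survival_add_le:
  assumes closed: "\<And>c b. c \<in> S \<Longrightarrow> ptm_step M b c \<in> S"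
    and decay: "\<And>c. c \<in> S \<Longrightarrow> survival M K c \<le> q"
    and "c \<in> S"
  shows "survival M (t + K) c \<le> q * survival M t c"
  using \<open>c \<in> S\<close>
proof (induction t arbitrary: c)
  case 0
  then show ?case
    using decay[of c] by (cases "halted M c") (simp_all add: event_prob_0 event_prob_halted)
next
  case (Suc t)
  show ?case
    using Suc.IH[OF closed[OF Suc.prems, of False]] Suc.IH[OF closed[OF Suc.prems, of True]]
    by (simp add: event_prob_Suc field_simps)
qed

text \<open>Survival shrinks by a factor \<open>q < 1\<close> every \<open>K\<close> steps. Hence
  the partial sums satisfy \<open>?s n \<le> ?s (n + K) \<le> K + q * ?s n\<close>, which bounds
  them without grouping the terms into blocks.\<close>

lemma summable_survival:
  assumes closed: "\<And>c b. c \<in> S \<Longrightarrow> ptm_step M b c \<in> S"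
    and path: "\<And>c. c \<in> S \<Longrightarrow> \<exists>bs. length bs = K \<and> halted M (fold (ptm_step M) bs c)"
    and "c \<in> S"
  shows "summable (\<lambda>t. survival M t c)"
proof -
  define q :: real where "q = 1 - 1 / 2 ^ K"
  have q: "0 \<le> q" "q < 1" by (auto simp: q_def)
  have decay: "survival M K d \<le> q" if "d \<in> S" for d
    using path[OF that] survival_le_of_halting_path unfolding q_def by blast
  have "(\<Sum>t<n. survival M t c) \<le> K / (1 - q)" for n
  proof -
    let ?s = "\<lambda>n. \<Sum>t<n. survival M t c"
    have mono: "?s n \<le> ?s (n + K)"
      by (intro sum_mono2) (auto simp: event_prob_nonneg)
    have "?s (n + K) = ?s K + (\<Sum>t<n. survival M (t + K) c)"
      by (induction n) (simp_all add: algebra_simps)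
    also have "\<dots> \<le> (\<Sum>t<K. 1) + (\<Sum>t<n. q * survival M t c)"
      using survival_add_le[OF closed decay \<open>c \<in> S\<close>]
      by (intro add_mono sum_mono event_prob_le_1) auto
    also have "\<dots> = K + q * ?s n"
      by (simp add: sum_distrib_left)
    finally have "?s n * (1 - q) \<le> K"
      using mono by (simp add: algebra_simps)
    then show ?thesis using q by (simp add: field_simps)
  qed
  then show ?thesis
    by (intro bounded_imp_summable[where B = "K / (1 - q)"])
      (simp_all only: event_prob_nonneg flip: lessThan_Suc_atMost)
qed

section \<open>Halting time, expected running time and output\<close>

lemma halted_ptm_run_mono:
  assumes "s \<le> t" "halted M (ptm_run M \<omega> s)"
  shows "ptm_run M \<omega> t = ptm_run M \<omega> s"
  using assms by (induction t rule: dec_induct) (simp_all add: ptm_step_halted)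

text \<open>Halted configurations are fixed points, so the \<open>LEAST\<close> in
  \<open>halting_time\<close> acts as a threshold.\<close>

lemma halted_ptm_run_iff:
  "halted M (ptm_run M \<omega> t) \<longleftrightarrow> ptm_halts M \<omega> \<and> halting_time M \<omega> \<le> t"
proof
  assume "halted M (ptm_run M \<omega> t)"
  then show "ptm_halts M \<omega> \<and> halting_time M \<omega> \<le> t"
    unfolding ptm_halts_def halting_time_def by (auto intro: Least_le)
next
  assume *: "ptm_halts M \<omega> \<and> halting_time M \<omega> \<le> t"
  then have "halted M (ptm_run M \<omega> (halting_time M \<omega>))"
    unfolding ptm_halts_def halting_time_def by (auto intro: LeastI)
  with * show "halted M (ptm_run M \<omega> t)"
    by (metis halted_ptm_run_mono)
qed

text \<open>The running time counts the times at which the machine has not halted; integrating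
  termwise gives the tail-sum formula for the expectation.\<close>

lemma running_time_eq_suminf:
  "running_time M \<omega> = (\<Sum>t. indicator {\<omega>. \<not> halted M (ptm_run M \<omega> t)} \<omega>)"
proof (cases "ptm_halts M \<omega>")
  case True
  have "(\<Sum>t. indicator {\<omega>. \<not> halted M (ptm_run M \<omega> t)} \<omega> :: ennreal) =
      (\<Sum>t<halting_time M \<omega>. indicator {\<omega>. \<not> halted M (ptm_run M \<omega> t)} \<omega>)"
    by (rule suminf_finite) (auto simp: halted_ptm_run_iff True)
  also have "\<dots> = of_nat (halting_time M \<omega>)"
    by (simp add: halted_ptm_run_iff True indicator_def)
  finally show ?thesis using True by (simp add: running_time_def)
next
  case False
  have "(\<Sum>t. indicator {\<omega>. \<not> halted M (ptm_run M \<omega> t)} \<omega>) = (\<Sum>t::nat. 1 :: ennreal)"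
    using False by (simp add: halted_ptm_run_iff indicator_def)
  also have "\<dots> = \<infinity>"
    by (simp flip: nn_integral_count_space_nat)
  finally show ?thesis using False by (simp add: running_time_def)
qed

lemma expected_running_time_finite:
  assumes "summable (\<lambda>t. survival M t (initial_config M))"
  shows "expected_running_time M < \<infinity>"
proof -
  interpret coin: prob_space coin_space by (rule prob_space_coin_space)
  have sets: "{\<omega>. \<not> halted M (ptm_run M \<omega> t)} \<in> sets coin_space" for t
    unfolding ptm_run_eq_fold by (rule stake_event_sets)
  have "expected_running_time M =
      (\<Sum>t. emeasure coin_space {\<omega>. \<not> halted M (ptm_run M \<omega> t)})"
    unfolding expected_running_time_def running_time_eq_suminf
    using sets by (subst nn_integral_suminf) auto
  also have "\<dots> = (\<Sum>t. ennreal (survival M t (initial_config M)))"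
    by (simp add: coin.emeasure_eq_measure ptm_run_eq_fold event_prob_def)
  also have "\<dots> = ennreal (\<Sum>t. survival M t (initial_config M))"
    by (rule suminf_ennreal2) (simp_all add: event_prob_nonneg assms)
  finally show ?thesis by simp
qed

text \<open>Makes the output event a union over \<open>t\<close> of events that depend on the first
  \<open>t\<close> tosses only.\<close>

lemma ptm_output_eq_Some_iff:
  "ptm_output M \<omega> = Some w \<longleftrightarrow>
    (\<exists>t. halted M (ptm_run M \<omega> t) \<and> written (ptm_run M \<omega> t) = w)"
proof
  assume "ptm_output M \<omega> = Some w"
  then show "\<exists>t. halted M (ptm_run M \<omega> t) \<and> written (ptm_run M \<omega> t) = w"
    by (intro exI[where x = "halting_time M \<omega>"])
      (simp add: ptm_output_def halted_ptm_run_iff split: if_splits)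
next
  assume "\<exists>t. halted M (ptm_run M \<omega> t) \<and> written (ptm_run M \<omega> t) = w"
  then obtain t where t: "halted M (ptm_run M \<omega> t)" "written (ptm_run M \<omega> t) = w"
    by blast
  then have halts: "ptm_halts M \<omega>" "halting_time M \<omega> \<le> t"
    by (simp_all add: halted_ptm_run_iff)
  then have "ptm_run M \<omega> t = ptm_run M \<omega> (halting_time M \<omega>)"
    by (intro halted_ptm_run_mono) (simp_all add: halted_ptm_run_iff)
  then show "ptm_output M \<omega> = Some w"
    using t(2) halts by (simp add: ptm_output_def)
qed

text \<open>
  Both \<open>h\<close> and the probability of having halted with output \<open>w\<close> by time \<open>t\<close> satisfy the averaging
  equation, so their distance is at most the probability of not having halted yet.
\<close>

lemma measure_output_eq:
  assumes closed: "\<And>c b. c \<in> S \<Longrightarrow> ptm_step M b c \<in> S"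
    and init: "initial_config M \<in> S"
    and summable: "summable (\<lambda>t. survival M t (initial_config M))"
    and harmonic: "\<And>c. c \<in> S \<Longrightarrow> \<not> halted M c \<Longrightarrow>
      h c = (h (ptm_step M False c) + h (ptm_step M True c)) / (2 :: real)"
    and boundary: "\<And>c. c \<in> S \<Longrightarrow> halted M c \<Longrightarrow> h c = of_bool (written c = w)"
    and bounds: "\<And>c. c \<in> S \<Longrightarrow> 0 \<le> h c \<and> h c \<le> 1"
  shows "measure coin_space {\<omega> \<in> space coin_space. ptm_output M \<omega> = Some w} =
    h (initial_config M)"
proof -
  interpret coin: prob_space coin_space by (rule prob_space_coin_space)
  let ?P = "\<lambda>c. halted M c \<and> written c = w"
  let ?c0 = "initial_config M"
  let ?A = "\<lambda>t. {\<omega>. ?P (ptm_run M \<omega> t)}"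
  have close: "\<bar>event_prob M ?P t c - h c\<bar> \<le> survival M t c" if "c \<in> S" for t c
    using that
  proof (induction t arbitrary: c)
    case 0
    then show ?case using bounds[OF 0] boundary[OF 0] by (auto simp: event_prob_0)
  next
    case (Suc t)
    show ?case
    proof (cases "halted M c")
      case True
      then show ?thesis using boundary[OF Suc.prems] by (simp add: event_prob_halted)
    next
      case False
      then show ?thesis
        using Suc.IH[OF closed[OF Suc.prems, of False]] Suc.IH[OF closed[OF Suc.prems, of True]]
          harmonic[OF Suc.prems] by (simp add: event_prob_Suc abs_if field_simps split: if_splits)
    qed
  qed
  have "(\<lambda>t. event_prob M ?P t ?c0 - h ?c0) \<longlonglongrightarrow> 0"
    using close[OF init] by (intro Lim_null_comparison[OF _ summable_LIMSEQ_zero[OF summable]]) simp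
  then have limit: "(\<lambda>t. event_prob M ?P t ?c0) \<longlonglongrightarrow> h ?c0"
    by (rule LIM_zero_cancel)
  \<comment> \<open>Having halted with output \<open>w\<close> is permanent, so continuity from
    below applies.\<close>
  have "incseq ?A"
    by (rule incseq_SucI) (auto simp: ptm_step_halted)
  moreover have "range ?A \<subseteq> sets coin_space"
    unfolding ptm_run_eq_fold by (auto intro: stake_event_sets)
  ultimately have "(\<lambda>t. measure coin_space (?A t)) \<longlonglongrightarrow> measure coin_space (\<Union>t. ?A t)"
    by (intro coin.finite_Lim_measure_incseq)
  moreover have "measure coin_space (?A t) = event_prob M ?P t ?c0" for t
    by (simp add: event_prob_def ptm_run_eq_fold)
  moreover have "(\<Union>t. ?A t) = {\<omega> \<in> space coin_space. ptm_output M \<omega> = Some w}"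
    by (auto simp: ptm_output_eq_Some_iff)
  ultimately show ?thesis
    using LIMSEQ_unique limit by auto
qed

section \<open>A machine for rational distributions\<close>

text \<open>
  Duplicating each entry of \<open>xs\<close> gives the list whose \<open>i\<close>-th entry is \<open>xs ! (i div 2)\<close>; the coin selects
  one of its two halves.
\<close>

definition split_half :: "bool \<Rightarrow> 'b list \<Rightarrow> 'b list" where
  "split_half b xs = map (\<lambda>i. xs ! ((if b then length xs + i else i) div 2)) [0..<length xs]"

lemma length_split_half [simp]: "length (split_half b xs) = length xs"
  by (simp add: split_half_def)

lemma set_split_half: "set (split_half b xs) \<subseteq> set xs"
  by (auto simp: split_half_def)

lemma sum_div_2: "(\<Sum>i<2 * n. f (i div 2)) = 2 * (\<Sum>i<n. f i)"
  for n :: nat and f :: "nat \<Rightarrow> real"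
  by (induction n) simp_all

text \<open>The martingale property of pools: together the two halves contain every entry of
  \<open>xs\<close> exactly twice.\<close>

lemma sum_list_split_half:
  "(\<Sum>x\<leftarrow>split_half False xs. f x) + (\<Sum>x\<leftarrow>split_half True xs. f x) =
    2 * (\<Sum>x\<leftarrow>xs. f x :: real)"
proof -
  let ?N = "length xs"
  have "(\<Sum>x\<leftarrow>split_half False xs. f x) + (\<Sum>x\<leftarrow>split_half True xs. f x) =
      (\<Sum>i<?N. f (xs ! (i div 2))) + (\<Sum>i<?N. f (xs ! ((?N + i) div 2)))"
    by (simp add: split_half_def sum.list_conv_set_nth atLeast0LessThan)
  also have "(\<Sum>i<?N. f (xs ! ((?N + i) div 2))) = (\<Sum>i\<in>{?N..<2 * ?N}. f (xs ! (i div 2)))"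
    by (rule sum.reindex_bij_witness[where i = "\<lambda>i. i - ?N" and j = "\<lambda>i. ?N + i"]) auto
  also have "(\<Sum>i<?N. f (xs ! (i div 2))) + \<dots> = (\<Sum>i<2 * ?N. f (xs ! (i div 2)))"
    by (subst sum.union_disjoint[symmetric]) (auto intro!: sum.cong)
  also have "\<dots> = 2 * (\<Sum>i<?N. f (xs ! i))"
    by (rule sum_div_2)
  finally show ?thesis
    by (simp add: sum.list_conv_set_nth atLeast0LessThan)
qed

section \<open>Pools of words and their transitions\<close>

definition constant_list :: "'b list \<Rightarrow> bool" where
  "constant_list xs \<longleftrightarrow> (\<forall>x \<in> set xs. x = hd xs)"

text \<open>A pool of empty words also takes the first branch, where \<open>hd (hd xs)\<close> is
  unspecified; that pool is the halting state, and the lemmas on steps exclude it.\<close>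

definition emit_or_split :: "bool \<Rightarrow> 'a list list \<Rightarrow> 'a list list \<times> 'a option" where
  "emit_or_split b xs =
    (if constant_list xs then (map tl xs, Some (hd (hd xs))) else (split_half b xs, None))"

text \<open>Bounding the word length and fixing the number of entries keeps the future state set
  finite.\<close>

definition pools :: "'a set \<Rightarrow> nat \<Rightarrow> nat \<Rightarrow> 'a list list set" where
  "pools \<Sigma> n N = {xs. set xs \<subseteq> {w \<in> lists \<Sigma>. length w \<le> n} \<and> length xs = N}"

lemma finite_pools: "finite \<Sigma> \<Longrightarrow> finite (pools \<Sigma> n N)"
  unfolding pools_def
  by (intro finite_lists_length_eq)
    (simp add: in_lists_conv_set subset_eq[symmetric] finite_lists_length_le)

lemma constant_list_hd_Nil:
  assumes "constant_list xs" "hd xs = []"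
  shows "xs = replicate (length xs) []"
  using assms by (intro replicate_eqI) (auto simp: constant_list_def)

text \<open>\<open>enc\<close> numbers the pools because machine states are natural numbers.\<close>

locale pool_machine =
  fixes \<Sigma> :: "'a set" and n N :: nat and enc :: "'a list list \<Rightarrow> nat" and start :: "'a list list"
  assumes fin: "finite \<Sigma>"
    and inj: "inj_on enc (pools \<Sigma> n N)"
    and start: "start \<in> pools \<Sigma> n N"
    and pos: "0 < N"
begin

text \<open>Decodes the state; meaningful on \<open>valid\<close> configurations.\<close>

definition pool :: "'a config \<Rightarrow> 'a list list" where
  "pool c = inv_into (pools \<Sigma> n N) enc (state c)"

text \<open>The finite control is the only memory: the tape stays blank and the head stays put.
  Halting means that the common word has been written to its end.\<close>

definition machine :: "'a ptm" where
  "machine =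
    \<lparr>ptm_states = enc ` pools \<Sigma> n N, ptm_symbols = {0}, ptm_start = enc start,
     ptm_halting = {enc (replicate N [])},
     ptm_delta = (\<lambda>b q g. case emit_or_split b (inv_into (pools \<Sigma> n N) enc q) of (ys, out) \<Rightarrow>
       (enc ys, 0, Stay, out))\<rparr>"

text \<open>Tape, head and output are unconstrained, since the transitions of \<open>machine\<close>
  depend on the coin and the state only.\<close>

definition valid :: "'a config set" where
  "valid = {c. state c \<in> enc ` pools \<Sigma> n N}"

lemma replicate_in_pools: "replicate N [] \<in> pools \<Sigma> n N"
  by (auto simp: pools_def)

lemma pool_in_pools: "c \<in> valid \<Longrightarrow> pool c \<in> pools \<Sigma> n N"
  unfolding valid_def pool_def by (simp add: inv_into_into)

lemma state_eq_enc_pool: "c \<in> valid \<Longrightarrow> state c = enc (pool c)"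
  unfolding valid_def pool_def by (simp add: f_inv_into_f)

lemma halted_iff: "c \<in> valid \<Longrightarrow> halted machine c \<longleftrightarrow> pool c = replicate N []"
  using inj_on_eq_iff[OF inj pool_in_pools replicate_in_pools, of c]
  by (simp add: halted_def machine_def state_eq_enc_pool)

lemma hd_in_set: "xs \<in> pools \<Sigma> n N \<Longrightarrow> hd xs \<in> set xs"
  using pos by (auto simp: pools_def)

lemma constant_list_hd_not_Nil:
  assumes "xs \<in> pools \<Sigma> n N" "xs \<noteq> replicate N []" "constant_list xs"
  shows "hd xs \<noteq> []"
  using assms constant_list_hd_Nil[of xs] by (auto simp: pools_def)

lemma emit_or_split_in_pools:
  assumes "xs \<in> pools \<Sigma> n N" "xs \<noteq> replicate N []" "emit_or_split b xs = (ys, out)"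
  shows "ys \<in> pools \<Sigma> n N" "out \<in> insert None (Some ` \<Sigma>)"
proof -
  let ?W = "{w \<in> lists \<Sigma>. length w \<le> n}"
  have "tl w \<in> ?W" if "w \<in> ?W" for w
    using that by (cases w) auto
  then have "tl ` set xs \<subseteq> ?W"
    using assms(1) unfolding pools_def by blast
  then show "ys \<in> pools \<Sigma> n N"
    using assms(1,3) subset_trans[OF set_split_half[of b xs]]
    unfolding emit_or_split_def pools_def mem_Collect_eq by (cases "constant_list xs") clarsimp+
  have "hd xs \<in> lists \<Sigma>"
    using hd_in_set[OF assms(1)] assms(1) unfolding pools_def by blast
  then have "hd (hd xs) \<in> \<Sigma>" if "constant_list xs"
    using constant_list_hd_not_Nil[OF assms(1,2) that] by (cases "hd xs") auto
  then show "out \<in> insert None (Some ` \<Sigma>)"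
    using assms(3) by (auto simp: emit_or_split_def split: if_splits)
qed

lemma is_ptm_machine: "is_ptm \<Sigma> machine"
proof -
  have "ptm_delta machine b q g \<in>
      enc ` pools \<Sigma> n N \<times> {0} \<times> UNIV \<times> insert None (Some ` \<Sigma>)"
    if "q \<in> enc ` pools \<Sigma> n N - {enc (replicate N [])}" for b q g
  proof -
    from that obtain xs where xs: "xs \<in> pools \<Sigma> n N" "q = enc xs" "xs \<noteq> replicate N []"
      by auto
    obtain ys out where e: "emit_or_split b xs = (ys, out)" by fastforce
    show ?thesis
      using emit_or_split_in_pools[OF xs(1,3) e] xs e inj
      by (simp add: machine_def)
  qed
  moreover have "finite (enc ` pools \<Sigma> n N)"
    using finite_pools[OF fin] by simp
  ultimately show ?thesis
    using start replicate_in_pools by (simp add: is_ptm_def machine_def)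
qed

text \<open>Lifts steps from encoded states to pools, so that later arguments can forget
  \<open>enc\<close>.\<close>

lemma step_machine:
  assumes "c \<in> valid" "\<not> halted machine c" "emit_or_split b (pool c) = (ys, out)"
  shows "ptm_step machine b c \<in> valid" "pool (ptm_step machine b c) = ys"
    "written (ptm_step machine b c) = written c @ (case out of None \<Rightarrow> [] | Some a \<Rightarrow> [a])"
proof -
  have ys: "ys \<in> pools \<Sigma> n N"
    using emit_or_split_in_pools(1)[OF pool_in_pools[OF assms(1)]] assms halted_iff by blast
  have step: "state (ptm_step machine b c) = enc ys"
    "written (ptm_step machine b c) = written c @ (case out of None \<Rightarrow> [] | Some a \<Rightarrow> [a])"
    using assms(2,3) by (simp_all add: ptm_step_def machine_def pool_def)
  show "ptm_step machine b c \<in> valid" "pool (ptm_step machine b c) = ys"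
    using ys inj by (simp_all add: valid_def pool_def step)
  show "written (ptm_step machine b c) = written c @ (case out of None \<Rightarrow> [] | Some a \<Rightarrow> [a])"
    by (rule step)
qed

lemma step_valid: "c \<in> valid \<Longrightarrow> ptm_step machine b c \<in> valid"
  by (cases "halted machine c"; cases "emit_or_split b (pool c)")
    (auto simp: ptm_step_halted intro: step_machine(1))

lemma initial_valid: "initial_config machine \<in> valid" "pool (initial_config machine) = start"
  using start inj by (simp_all add: valid_def pool_def initial_config_def machine_def)

text \<open>Each step moves one letter of the common word to the output; tosses left over after the
  halt change nothing, so an upper bound \<open>m\<close> suffices.\<close>

lemma constant_pool_halts:
  assumes "c \<in> valid" "constant_list (pool c)" "length (hd (pool c)) \<le> m"
  shows "halted machine (fold (ptm_step machine) (replicate m False) c)"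
  using assms
proof (induction m arbitrary: c)
  case 0
  then show ?case
    using constant_list_hd_Nil[of "pool c"] pool_in_pools[of c] by (simp add: halted_iff pools_def)
next
  case (Suc m)
  show ?case
  proof (cases "halted machine c")
    case True
    then show ?thesis by (metis fold_step_halted)
  next
    case False
    have "emit_or_split False (pool c) = (map tl (pool c), Some (hd (hd (pool c))))"
      using Suc.prems by (simp add: emit_or_split_def)
    note step = step_machine[OF Suc.prems(1) False this]
    have "pool c \<noteq> []"
      using pool_in_pools[OF Suc.prems(1)] pos by (auto simp: pools_def)
    then have "hd (map tl (pool c)) = tl (hd (pool c))"
      by (simp add: hd_map)
    moreover from this have "constant_list (map tl (pool c))"
      using Suc.prems(2) by (auto simp: constant_list_def)
    ultimately show ?thesis
      using Suc.IH[OF step(1)] Suc.prems(3) by (simp add: step)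
  qed
qed

text \<open>
  Tails keep duplicating the first entry, so the pool becomes constant after fewer than
  \<open>N\<close> consecutive tails.
\<close>

lemma valid_halts:
  assumes "c \<in> valid" "\<forall>i<k. pool c ! i = hd (pool c)" "0 < k" "N \<le> k + d"
  shows "halted machine (fold (ptm_step machine) (replicate (d + n) False) c)"
  using assms
proof (induction d arbitrary: c k)
  case 0
  \<comment> \<open>Here \<open>N \<le> k\<close>, so the constant prefix is the whole pool, and the
    remaining \<open>n\<close> tosses suffice to write its word.\<close>
  have "hd (pool c) \<in> set (pool c)" "pool c \<in> pools \<Sigma> n N"
    using hd_in_set pool_in_pools 0 by auto
  moreover from this have "length (hd (pool c)) \<le> n"
    by (auto simp: pools_def)
  ultimately show ?case
    using 0 by (intro constant_pool_halts) (auto simp: constant_list_def in_set_conv_nth pools_def)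
next
  case (Suc d)
  have pool: "hd (pool c) \<in> set (pool c)" "pool c \<in> pools \<Sigma> n N"
    using hd_in_set pool_in_pools Suc.prems by auto
  show ?case
  proof (cases "constant_list (pool c)")
    case True
    have "length (hd (pool c)) \<le> Suc d + n"
      using pool by (auto simp: pools_def)
    then show ?thesis using constant_pool_halts Suc.prems(1) True by blast
  next
    case False
    then obtain i where "i < length (pool c)" "pool c ! i \<noteq> hd (pool c)"
      by (auto simp: constant_list_def in_set_conv_nth)
    \<comment> \<open>The differing entry lies beyond the prefix, so position \<open>k\<close>
      exists and the prefix has room to grow.\<close>
    then have "k < N"
      using pool(2) Suc.prems(2) by (metis (mono_tags, lifting) linorder_neqE_nat mem_Collect_eq
          order.strict_trans pools_def)
    have "\<not> halted machine c"
      using False halted_iff[OF Suc.prems(1)] pos by (auto simp: constant_list_def)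
    moreover have "emit_or_split False (pool c) = (split_half False (pool c), None)"
      using False by (simp add: emit_or_split_def)
    ultimately have step: "ptm_step machine False c \<in> valid"
      "pool (ptm_step machine False c) = split_half False (pool c)"
      using step_machine Suc.prems(1) by blast+
    \<comment> \<open>Position \<open>i \<le> k\<close> receives entry \<open>i div 2\<close>, which
      lies in the old prefix because \<open>0 < k\<close>.\<close>
    have nth: "split_half False (pool c) ! i = hd (pool c)" if "i < Suc k" for i
    proof -
      have "i < length (pool c)" "i div 2 < k"
        using that \<open>k < N\<close> pool(2) \<open>0 < k\<close> by (auto simp: pools_def)
      then show ?thesis using Suc.prems(2) by (simp add: split_half_def)
    qed
    moreover have "hd (split_half False (pool c)) = split_half False (pool c) ! 0"
      using pool(2) pos by (intro hd_conv_nth) (auto simp: pools_def simp flip: length_0_conv)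
    ultimately show ?thesis
      using Suc.IH[OF step(1), of "Suc k"] Suc.prems(4) by (simp add: step)
  qed
qed

lemma survival_summable: "summable (\<lambda>t. survival machine t (initial_config machine))"
proof (rule summable_survival[OF step_valid _ initial_valid(1)])
  fix c assume c: "c \<in> valid"
  \<comment> \<open>The first entry alone is a constant prefix, so \<open>k = 1\<close> and
    \<open>d = N\<close> give a path length that is the same for all valid configurations.\<close>
  have "pool c ! 0 = hd (pool c)"
    using pool_in_pools[OF c] pos by (intro hd_conv_nth[symmetric]) (auto simp: pools_def)
  then show "\<exists>bs. length bs = N + n \<and> halted machine (fold (ptm_step machine) bs c)"
    using valid_halts[OF c, of 1 N] by (intro exI[where x = "replicate (N + n) False"]) simp
qed

text \<open>The conditional probability that \<open>w\<close> is the final output, given the configuration.\<close>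

definition output_prob :: "'a list \<Rightarrow> 'a config \<Rightarrow> real" where
  "output_prob w c = (\<Sum>x\<leftarrow>pool c. of_bool (written c @ x = w)) / N"

text \<open>In a constant pool, moving a letter from each \<open>x\<close> to the output leaves
  \<open>written c @ x\<close> unchanged; otherwise this is
  \<open>sum_list_split_half\<close>.\<close>

lemma output_prob_step:
  assumes "c \<in> valid" "\<not> halted machine c"
  shows "output_prob w c =
    (output_prob w (ptm_step machine False c) + output_prob w (ptm_step machine True c)) / 2"
proof (cases "constant_list (pool c)")
  case True
  have "output_prob w (ptm_step machine b c) = output_prob w c" for b
  proof -
    have "emit_or_split b (pool c) = (map tl (pool c), Some (hd (hd (pool c))))"
      using True by (simp add: emit_or_split_def)
    note step = step_machine[OF assms this]
    have "hd (pool c) \<noteq> []"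
      using assms True constant_list_hd_not_Nil halted_iff pool_in_pools by blast
    then have "hd (hd (pool c)) # tl x = x" if "x \<in> set (pool c)" for x
      using that True by (auto simp: constant_list_def)
    then show ?thesis
      by (simp add: output_prob_def step o_def cong: map_cong)
  qed
  then show ?thesis by simp
next
  case False
  have "emit_or_split b (pool c) = (split_half b (pool c), None)" for b
    using False by (simp add: emit_or_split_def)
  note step = step_machine[OF assms this]
  show ?thesis
    using sum_list_split_half[of "\<lambda>x. of_bool (written c @ x = w)" "pool c"] pos
    by (simp add: output_prob_def step field_simps)
qed

text \<open>\<open>output_prob w\<close> is harmonic and, since all entries are empty at a halt,
  becomes the indicator of output \<open>w\<close> there. Its initial value is the frequency of
  \<open>w\<close> in \<open>start\<close>.\<close>

lemma has_output_distribution_machine: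
  "has_output_distribution machine (pmf_of_multiset (mset start))"
  unfolding has_output_distribution_def
proof
  fix w
  have "measure coin_space {\<omega> \<in> space coin_space. ptm_output machine \<omega> = Some w} =
      output_prob w (initial_config machine)"
  proof (rule measure_output_eq[OF step_valid initial_valid(1) survival_summable output_prob_step])
    fix c assume c: "c \<in> valid"
    then have len: "length (pool c) = N"
      using pool_in_pools by (auto simp: pools_def)
    have "(\<Sum>x\<leftarrow>pool c. of_bool (written c @ x = w)) \<le> (\<Sum>x\<leftarrow>pool c. 1 :: real)"
      by (intro sum_list_mono) auto
    then show "0 \<le> output_prob w c \<and> output_prob w c \<le> 1"
      using pos len
      by (auto simp: output_prob_def sum_list_triv intro!: sum_list_nonneg divide_nonneg_nonneg)
    show "output_prob w c = of_bool (written c = w)" if "halted machine c"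
      using that c pos by (simp add: halted_iff output_prob_def sum_list_replicate)
  qed
  also have "\<dots> = count (mset start) w / N"
  proof -
    have "(\<Sum>x\<leftarrow>xs. of_bool (x = w)) = real (count (mset xs) w)" for xs
      by (induction xs) auto
    then show ?thesis
      by (simp add: output_prob_def initial_valid(2)) (simp add: initial_config_def)
  qed
  also have "\<dots> = pmf (pmf_of_multiset (mset start)) w"
    using start pos by (subst pmf_of_multiset) (auto simp: pools_def)
  finally show "measure coin_space {\<omega> \<in> space coin_space. ptm_output machine \<omega> = Some w} =
    pmf (pmf_of_multiset (mset start)) w" .
qed

end

text \<open>Instantiates the pool machine with a listing of \<open>X\<close>, the maximal word
  length and a numbering of the finitely many pools.\<close>

lemma ptm_samples_multiset:
  fixes \<Sigma> :: "'a set"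
  assumes "finite \<Sigma>" "X \<noteq> {#}" "set_mset X \<subseteq> lists \<Sigma>"
  shows "\<exists>M. is_ptm \<Sigma> M \<and> expected_running_time M < \<infinity> \<and>
    has_output_distribution M (pmf_of_multiset X)"
proof -
  obtain xs where xs: "mset xs = X" using ex_mset by blast
  define n where "n = Max (length ` set xs)"
  obtain enc :: "'a list list \<Rightarrow> nat" where enc: "inj_on enc (pools \<Sigma> n (length xs))"
    using finite_imp_inj_to_nat_seg[OF finite_pools[OF assms(1)]] by blast
  interpret pool_machine \<Sigma> n "length xs" enc xs
    using assms enc xs by unfold_locales (auto simp: pools_def n_def)
  show ?thesis
    using is_ptm_machine expected_running_time_finite[OF survival_summable]
      has_output_distribution_machine xs by blast
qed

section \<open>Feasibility and the inequalities\<close>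

lemma common_denominator:
  fixes g :: "'b \<Rightarrow> rat"
  assumes "finite I"
  shows "\<exists>d::nat. 0 < d \<and> (\<forall>w \<in> I. of_nat d * g w \<in> \<int>)"
  using assms
proof (induction rule: finite_induct)
  case empty
  then show ?case by auto
next
  case (insert v I)
  then obtain d where d: "0 < d" "\<And>w. w \<in> I \<Longrightarrow> of_nat d * g w \<in> \<int>" by blast
  obtain x y where xy: "g v = of_int x / of_int y" "0 < y"
    by (metis quotient_of_div quotient_of_denom_pos surj_pair)
  have "of_nat (d * nat y) * g v = of_int (int d * x)"
    using xy by (simp add: of_nat_nat)
  then have "of_nat (d * nat y) * g v \<in> \<int>"
    by (metis Ints_of_int)
  moreover have "of_nat (d * nat y) * g w \<in> \<int>" if "w \<in> I" for w
  proof -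
    have "of_nat (d * nat y) * g w = of_nat (nat y) * (of_nat d * g w)"
      by (simp add: mult_ac)
    also have "\<dots> \<in> \<int>" by (rule Ints_mult[OF Ints_of_nat d(2)[OF that]])
    finally show ?thesis .
  qed
  moreover have "0 < d * nat y"
    using d xy by simp
  ultimately show ?case by blast
qed

text \<open>With a common denominator \<open>d\<close>, give \<open>w\<close> the multiplicity
  \<open>d * g w\<close>; the weights sum to 1, so the multiset has size \<open>d\<close>.\<close>

lemma rational_weights_multiset:
  fixes g :: "'b \<Rightarrow> rat"
  assumes "finite I" "\<And>w. w \<in> I \<Longrightarrow> 0 \<le> g w" "(\<Sum>w\<in>I. g w) = 1"
  shows "\<exists>X. X \<noteq> {#} \<and> set_mset X \<subseteq> I \<and> (\<forall>w \<in> I. pmf (pmf_of_multiset X) w = of_rat (g w))"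
proof -
  obtain d :: nat where d: "0 < d" "\<And>w. w \<in> I \<Longrightarrow> of_nat d * g w \<in> \<int>"
    using common_denominator[OF assms(1)] by blast
  define k where "k w = nat \<lfloor>of_nat d * g w\<rfloor>" for w
  have k: "of_nat (k w) = of_nat d * g w" if "w \<in> I" for w
    using d(2)[OF that] assms(2)[OF that] by (auto simp: k_def elim!: Ints_cases)
  define X where "X = (\<Sum>w\<in>I. replicate_mset (k w) w)"
  have count: "count X w = (if w \<in> I then k w else 0)" for w
    using assms(1) by (simp add: X_def count_sum)
  have "size X = (\<Sum>w\<in>I. k w)"
    by (simp add: X_def size_multiset_sum)
  then have "of_nat (size X) = (\<Sum>w\<in>I. of_nat d * g w)"
    using k by simp
  then have "of_nat (size X) = (of_nat d :: rat)"
    by (simp add: assms(3) flip: sum_distrib_left)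
  then have size: "size X = d" by simp
  then have "X \<noteq> {#}" using d(1) by auto
  moreover have "set_mset X \<subseteq> I"
    using count by (metis count_eq_zero_iff subsetI)
  moreover have "pmf (pmf_of_multiset X) w = of_rat (g w)" if "w \<in> I" for w
  proof -
    have "of_rat (of_nat (k w)) = (of_rat (of_nat d * g w) :: real)"
      using k[OF that] by simp
    then show ?thesis
      using \<open>X \<noteq> {#}\<close> d(1) that by (simp add: count size of_rat_mult)
  qed
  ultimately show ?thesis by blast
qed

text \<open>A zero divisor makes the quotient infinite for every \<open>x\<close>: this refutes an
  upper bound, and trivially satisfies the lower bound in \<open>le_ext_divide_iff\<close>.\<close>

lemma ext_divide_le_iff:
  "0 \<le> y \<Longrightarrow> ext_divide x y \<le> ereal (of_rat z) \<longleftrightarrow> y \<noteq> 0 \<and> x \<le> y * z"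
  by (auto simp: ext_divide_def of_rat_less_eq field_simps)

lemma le_ext_divide_iff:
  "0 \<le> y \<Longrightarrow> ereal (of_rat z) \<le> ext_divide x y \<longleftrightarrow> y = 0 \<or> y * z \<le> x"
  by (auto simp: ext_divide_def of_rat_less_eq field_simps)

lemma finite_improvisations:
  assumes "is_ci_instance L C"
  shows "finite (improvisations L C)"
proof (rule finite_subset)
  show "improvisations L C \<subseteq> {w. set w \<subseteq> alphabet C \<and> length w \<le> max_length C}"
    using assms by (fastforce simp: improvisations_def is_ci_instance_def)
  show "finite {w. set w \<subseteq> alphabet C \<and> length w \<le> max_length C}"
    using assms by (intro finite_lists_length_le) (simp add: is_ci_instance_def)
qed

text \<open>The inequalities over \<open>rat\<close> with denominators cleared. The first conjunct
  already forces \<open>rho C \<noteq> 0\<close>.\<close>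

definition ci_inequalities ::
    "('spec::countable \<Rightarrow> 'a list set) \<Rightarrow> ('spec, 'a) ci_instance \<Rightarrow> bool" where
  "ci_inequalities L C \<longleftrightarrow>
    1 \<le> rho C * of_nat (card (improvisations L C)) \<and>
    lam C * of_nat (card (improvisations L C)) \<le> 1 \<and>
    1 - eps C \<le> rho C * of_nat (card (admissible L C)) \<and>
    lam C * (of_nat (card (improvisations L C)) - of_nat (card (admissible L C))) \<le> eps C"

text \<open>For \<open>rho C = 0\<close> and \<open>eps C = 1\<close> the two forms of (b) disagree,
  but then (a) fails on both sides.\<close>

lemma ext_divide_inequalities_iff:
  assumes "is_ci_instance L C" "I = improvisations L C" "A = admissible L C"
  shows "ext_divide 1 (rho C) \<le> ereal (real (card I)) \<and>
      ereal (real (card I)) \<le> ext_divide 1 (lam C) \<and>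
      ext_divide (1 - eps C) (rho C) \<le> ereal (real (card A)) \<and>
      ereal (real (card I) - real (card A)) \<le> ext_divide (eps C) (lam C) \<longleftrightarrow>
    ci_inequalities L C"
proof -
  have bounds: "0 \<le> rho C" "0 \<le> lam C" "0 \<le> eps C"
    using assms(1) by (auto simp: is_ci_instance_def)
  \<comment> \<open>Shapes the cardinalities as images of rationals; the difference is rewritten
    before its two terms.\<close>
  have cast: "real k - real l = of_rat (of_nat k - of_nat l)" "real k = of_rat (of_nat k)" for k l
    by (simp_all add: of_rat_diff)
  show ?thesis
    unfolding cast(1) unfolding cast(2) ext_divide_le_iff[OF bounds(1)] le_ext_divide_iff[OF bounds(2)]
      ci_inequalities_def assms(2,3)
    using bounds by auto
qed

lemma feasible_imp_inequalities:
  assumes ci: "is_ci_instance L C" and "feasible L C"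
  shows "ci_inequalities L C"
proof -
  define I A where "I = improvisations L C" and "A = admissible L C"
  obtain D where D: "measure_pmf.prob D I = 1" "measure_pmf.prob D A \<ge> 1 - of_rat (eps C)"
    "\<And>w. w \<in> I \<Longrightarrow> of_rat (lam C) \<le> pmf D w" "\<And>w. w \<in> I \<Longrightarrow> pmf D w \<le> of_rat (rho C)"
    using assms(2) unfolding feasible_def improvising_distribution_def I_def A_def by blast
  have fin: "finite I" "A \<subseteq> I"
    using finite_improvisations[OF ci] by (auto simp: I_def A_def admissible_def)
  have sum: "measure_pmf.prob D B = (\<Sum>w\<in>B. pmf D w)" if "B \<subseteq> I" for B
    using that fin by (intro measure_measure_pmf_finite) (auto intro: finite_subset)
  have upper: "measure_pmf.prob D B \<le> of_rat (rho C) * card B" if "B \<subseteq> I" for B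
    using sum_mono[of B "pmf D" "\<lambda>_. of_rat (rho C)"] D(4) that sum[OF that]
    by (auto simp: mult.commute)
  have lower: "of_rat (lam C) * card B \<le> measure_pmf.prob D B" if "B \<subseteq> I" for B
    using sum_mono[of B "\<lambda>_. of_rat (lam C)" "pmf D"] D(3) that sum[OF that]
    by (auto simp: mult.commute)
  have card: "real (card (I - A)) = real (card I) - real (card A)"
    using fin by (simp add: card_Diff_subset finite_subset card_mono of_nat_diff)
  \<comment> \<open>Mass 1 on \<open>I\<close> and at least \<open>1 - eps C\<close> on
    \<open>A\<close> leave at most \<open>eps C\<close> for \<open>I - A\<close>.\<close>
  have "measure_pmf.prob D (I - A) = measure_pmf.prob D I - measure_pmf.prob D A"
    using fin(2) by (intro measure_pmf.finite_measure_Diff) auto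
  then have "of_rat (lam C) * (real (card I) - real (card A)) \<le> of_rat (eps C)"
    using lower[of "I - A"] D(1,2) by (simp add: card)
  moreover have "1 \<le> of_rat (rho C) * real (card I)" "of_rat (lam C) * real (card I) \<le> 1"
    "1 - of_rat (eps C) \<le> of_rat (rho C) * real (card A)"
    using upper[of I] lower[of I] upper[of A] D(1,2) fin by auto
  \<comment> \<open>\<open>D\<close> may have irrational weights, but the summed bounds compare
    rationals and so descend from \<open>real\<close> to \<open>rat\<close>.\<close>
  ultimately have
    "of_rat (lam C * (of_nat (card I) - of_nat (card A))) \<le> (of_rat (eps C) :: real)"
    "of_rat 1 \<le> (of_rat (rho C * of_nat (card I)) :: real)"
    "of_rat (lam C * of_nat (card I)) \<le> (of_rat 1 :: real)"
    "of_rat (1 - eps C) \<le> (of_rat (rho C * of_nat (card A)) :: real)"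
    by (simp_all add: of_rat_mult of_rat_diff)
  then show ?thesis
    unfolding of_rat_less_eq ci_inequalities_def I_def A_def by blast
qed

text \<open>
  The mass \<open>t\<close> given to \<open>A\<close> is the largest that the bounds allow, spread uniformly over \<open>A\<close>; the rest
  is spread uniformly over \<open>I - A\<close>.
\<close>

lemma exists_rational_weights:
  fixes a b :: nat and \<epsilon> l r :: rat
  assumes "0 \<le> l" "0 \<le> r" "1 \<le> r * of_nat (a + b)" "l * of_nat (a + b) \<le> 1"
    "1 - \<epsilon> \<le> r * of_nat a" "l * of_nat b \<le> \<epsilon>"
  shows "\<exists>p q. p * of_nat a + q * of_nat b = 1 \<and> 1 - \<epsilon> \<le> p * of_nat a \<and>
    (a \<noteq> 0 \<longrightarrow> l \<le> p \<and> p \<le> r) \<and> (b \<noteq> 0 \<longrightarrow> l \<le> q \<and> q \<le> r)"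
proof -
  define t where "t = min (r * of_nat a) (1 - l * of_nat b)"
  define p where "p = t / of_nat a"
  define q where "q = (1 - t) / of_nat b"
  \<comment> \<open>Yields \<open>l \<le> r\<close> by cancelling the positive \<open>a + b\<close>
    in \<open>l * (a + b) \<le> 1 \<le> r * (a + b)\<close>.\<close>
  have "l * of_nat (a + b) \<le> r * of_nat (a + b)" "0 < a + b"
    using assms by (auto intro: Nat.gr0I)
  then have "l \<le> r"
    by (metis mult_le_cancel_right_pos of_nat_0_less_iff)
  then have "l * of_nat k \<le> r * of_nat k" for k
    by (simp add: mult_right_mono)
  note this[of a] this[of b]
  then have t: "l * of_nat a \<le> t" "t \<le> r * of_nat a" "l * of_nat b \<le> 1 - t" "1 - t \<le> r * of_nat b"
    "1 - \<epsilon> \<le> t"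
    using assms by (auto simp: t_def algebra_simps min_def)
  \<comment> \<open>If \<open>a = 0\<close>, the bounds force \<open>t = 0\<close>, in accord with
    \<open>p = t / 0 = 0\<close>; if \<open>b = 0\<close>, they force \<open>t = 1\<close>
    likewise.\<close>
  have "p * of_nat a = t" "q * of_nat b = 1 - t"
    using t by (auto simp: p_def q_def)
  moreover have "a \<noteq> 0 \<longrightarrow> l \<le> p \<and> p \<le> r" "b \<noteq> 0 \<longrightarrow> l \<le> q \<and> q \<le> r"
    using t by (auto simp: p_def q_def field_simps)
  ultimately show ?thesis
    using t(5) by (intro exI[where x = p] exI[where x = q]) simp
qed

text \<open>The distribution is obtained as a multiset because that is the form which
  \<open>ptm_samples_multiset\<close> can sample.\<close>

lemma inequalities_imp_multiset:
  assumes ci: "is_ci_instance L C" and ineq: "ci_inequalities L C"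
  shows "\<exists>X. X \<noteq> {#} \<and> set_mset X \<subseteq> lists (alphabet C) \<and>
    improvising_distribution L C (pmf_of_multiset X)"
proof -
  define I A where "I = improvisations L C" and "A = admissible L C"
  have fin: "finite I" "A \<subseteq> I" "finite A"
    using finite_improvisations[OF ci] by (auto simp: I_def A_def admissible_def)
  have bounds: "0 \<le> lam C" "0 \<le> rho C"
    using ci by (auto simp: is_ci_instance_def)
  have card: "card I = card A + card (I - A)"
    using fin by (simp add: card_Diff_subset card_mono)
  obtain p q where pq: "p * of_nat (card A) + q * of_nat (card (I - A)) = 1"
    "1 - eps C \<le> p * of_nat (card A)"
    "card A \<noteq> 0 \<longrightarrow> lam C \<le> p \<and> p \<le> rho C"
    "card (I - A) \<noteq> 0 \<longrightarrow> lam C \<le> q \<and> q \<le> rho C"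
    using exists_rational_weights[OF bounds, of "card A" "card (I - A)" "eps C"] ineq card
    unfolding ci_inequalities_def by (auto simp flip: I_def A_def)
  define g where "g w = (if w \<in> A then p else q)" for w
  \<comment> \<open>A word in \<open>A\<close> or in \<open>I - A\<close> makes the respective
    cardinality nonzero, which unlocks the guarded bounds.\<close>
  have g: "lam C \<le> g w" "g w \<le> rho C" if "w \<in> I" for w
    using pq(3,4) that fin by (auto simp: g_def)
  have sumA: "(\<Sum>w\<in>A. g w) = p * of_nat (card A)"
    by (simp add: g_def mult.commute)
  have "(\<Sum>w\<in>I. g w) = (\<Sum>w\<in>I - A. g w) + (\<Sum>w\<in>A. g w)"
    using fin by (intro sum.subset_diff)
  also have "(\<Sum>w\<in>I - A. g w) = q * of_nat (card (I - A))"
    by (simp add: g_def mult.commute)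
  finally have sumI: "(\<Sum>w\<in>I. g w) = 1"
    using pq(1) sumA by simp
  have "0 \<le> g w" if "w \<in> I" for w
    using g(1)[OF that] bounds(1) by simp
  then obtain X where X: "X \<noteq> {#}" "set_mset X \<subseteq> I"
    "\<And>w. w \<in> I \<Longrightarrow> pmf (pmf_of_multiset X) w = of_rat (g w)"
    using rational_weights_multiset[OF fin(1) _ sumI] by blast
  have prob: "measure_pmf.prob (pmf_of_multiset X) B = of_rat (\<Sum>w\<in>B. g w)" if "B \<subseteq> I" for B
    using that fin X(3) by (subst measure_measure_pmf_finite)
      (auto intro: finite_subset intro!: sum.cong simp: of_rat_sum)
  have "I \<subseteq> lists (alphabet C)"
    using ci by (auto simp: I_def improvisations_def is_ci_instance_def)
  moreover have "measure_pmf.prob (pmf_of_multiset X) I = 1"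
    using prob[of I] sumI by simp
  moreover have "1 - of_rat (eps C) \<le> measure_pmf.prob (pmf_of_multiset X) A"
  proof -
    have "of_rat (1 - eps C) \<le> (of_rat (\<Sum>w\<in>A. g w) :: real)"
      unfolding of_rat_less_eq sumA by (rule pq(2))
    then show ?thesis by (simp add: prob[OF fin(2)] of_rat_diff)
  qed
  ultimately have "improvising_distribution L C (pmf_of_multiset X)"
    using X g unfolding improvising_distribution_def
    by (auto simp: of_rat_less_eq simp flip: I_def A_def)
  then show ?thesis
    using X \<open>I \<subseteq> lists (alphabet C)\<close> by blast
qed

theorem theorem3p1:
  fixes L :: "'spec::countable \<Rightarrow> 'a list set"
    and C :: "('spec, 'a) ci_instance"
    and I A :: "'a list set"
  assumes "is_ci_instance L C"
    and "I = improvisations L C"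
    and "A = admissible L C"
  defines "inequalities \<equiv>
      ext_divide 1 (rho C) \<le> ereal (real (card I)) \<and>
      ereal (real (card I)) \<le> ext_divide 1 (lam C) \<and>
      ext_divide (1 - eps C) (rho C) \<le> ereal (real (card A)) \<and>
      ereal (real (card I) - real (card A)) \<le> ext_divide (eps C) (lam C)"
  shows "(feasible L C \<longleftrightarrow> inequalities) \<and>
         (inequalities \<longleftrightarrow> (\<exists>M. is_improviser L C M))"
proof -
  have ineq: "inequalities \<longleftrightarrow> ci_inequalities L C"
    unfolding inequalities_def using assms(1-3) by (rule ext_divide_inequalities_iff)
  \<comment> \<open>The equivalences follow from a cycle: feasibility, inequalities, improviser,
    feasibility.\<close>
  have "feasible L C \<Longrightarrow> inequalities"
    using feasible_imp_inequalities[OF assms(1)] ineq by blast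
  moreover have "\<exists>M. is_improviser L C M" if inequalities
  proof -
    have "finite (alphabet C)"
      using assms(1) by (simp add: is_ci_instance_def)
    moreover have "ci_inequalities L C"
      using that ineq by simp
    then obtain X where "X \<noteq> {#}" "set_mset X \<subseteq> lists (alphabet C)"
      and X: "improvising_distribution L C (pmf_of_multiset X)"
      using inequalities_imp_multiset[OF assms(1)] by blast
    ultimately obtain M where "is_ptm (alphabet C) M" "expected_running_time M < \<infinity>"
      "has_output_distribution M (pmf_of_multiset X)"
      using ptm_samples_multiset by blast
    with X show ?thesis
      unfolding is_improviser_def by blast
  qed
  moreover have "is_improviser L C M \<Longrightarrow> feasible L C" for M
    by (auto simp: is_improviser_def feasible_def)
  ultimately show ?thesis by blast
qed

end
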